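(* Let $\mathcal{A}$ be a bicomplete preorder, let $F$ be a monad on $\mathcal{A}$, and let $C$ be a comonad on $\mathcal{A}$. Then the following conditions are equivalent: (i) There exists a model structure on $\mathcal{A}$ whose cofibrant replacement comonad is naturally isomorphic to $C$, and whose fibrant replacement monad is naturally isomorphic to $F$. (ii) $F$ and $C$ are each idempotent, $F$ commutes with $C$ up to isomorphism (i.e. $FCX\cong CFX$ for all $X\in\mathcal{A}$), and if $X,Y$ are elements of $\mathcal{A}$ such that $X\leq CY$ and $FX\leq Y$, then $FX\leq CY$.
   Context: A preorder (a set with a reflexive transitive relation $\leq$) is regarded as a small category with exactly one morphism $X\to Y$ if $X\leq Y$ and none otherwise; $X\cong Y$ means $X\leq Y\leq X$. Functors are order-preserving maps. A monad $F$ on $\mathcal{A}$ is thus an order-preserving map with $X\leq FX$ and $FFX\leq FX$; comonads are dual. A bicomplete preorder is one having all small limits (meets) and colimits (joins); $0$ and $1$ denote an initial and a terminal object. A weak factorization system on a category is a pair $(\mathcal{L},\mathcal{R})$ of classes of morphisms such that every morphism factors as a map in $\mathcal{L}$ followed by a map in $\mathcal{R}$, $\mathcal{L}$ is the class of maps with the left lifting property with respect to $\mathcal{R}$, and $\mathcal{R}$ is the class of maps with the right lifting property with respect to $\mathcal{L}$. A model structure is a triple $(\mathrm{cof},\mathrm{we},\mathrm{fib})$ of retract-closed subcategories containing all objects (cofibrations, weak equivalences, fibrations) such that $(\mathrm{cof}\cap \mathrm{we},\mathrm{fib})$ and $(\mathrm{cof},\mathrm{we}\cap \mathrm{fib})$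 are weak factorization systems and $\mathrm{we}$ has the two-out-of-three property. Maps in $\mathrm{cof}\cap\mathrm{we}$ are acyclic cofibrations; maps in $\mathrm{we}\cap\mathrm{fib}$ are acyclic fibrations. In a model structure on a preorder with $0$ and $1$, factorizations are unique up to isomorphism and functorial. The fibrant replacement of $X$ is the object $FX$ (unique up to isomorphism) with $X\to FX$ an acyclic cofibration and $FX\to 1$ a fibration; the cofibrant replacement of $X$ is the object $CX$ with $0\to CX$ a cofibration and $CX\to X$ an acyclic fibration. These define a monad and a comonad respectively, the fibrant replacement monad and cofibrant replacement comonad. *)

theory Defs
  imports Main
begin

text \<open>
  A preorder, given by the class \<^class>\<open>preorder\<close>, is regarded as a category with objects the
  elements of the type and one morphism \<open>x \<rightarrow> y\<close> whenever \<open>x \<le> y\<close>. A morphism is encoded as the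
  pair \<open>(x, y)\<close>; parallel morphisms are equal, so all diagrams commute automatically.
\<close>

definition arrows :: "('a::preorder \<times> 'a) set" where
  "arrows = {(x, y). x \<le> y}"

definition iso :: "'a::preorder \<Rightarrow> 'a \<Rightarrow> bool" (infix "\<cong>" 50) where
  "x \<cong> y \<longleftrightarrow> x \<le> y \<and> y \<le> x"

definition is_initial :: "'a::preorder \<Rightarrow> bool" where
  "is_initial z \<longleftrightarrow> (\<forall>x. z \<le> x)"

definition is_terminal :: "'a::preorder \<Rightarrow> bool" where
  "is_terminal t \<longleftrightarrow> (\<forall>x. x \<le> t)"

text \<open>
  A limit (colimit) of a small diagram is a greatest lower (least upper) bound of its set of
  objects; it is determined only up to \<open>\<cong>\<close>.
\<close>

definition (in preorder) is_meet :: "'a set \<Rightarrow> 'a \<Rightarrow> bool" where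
  "is_meet S m \<longleftrightarrow> (\<forall>s\<in>S. m \<le> s) \<and> (\<forall>x. (\<forall>s\<in>S. x \<le> s) \<longrightarrow> x \<le> m)"

definition (in preorder) is_join :: "'a set \<Rightarrow> 'a \<Rightarrow> bool" where
  "is_join S j \<longleftrightarrow> (\<forall>s\<in>S. s \<le> j) \<and> (\<forall>x. (\<forall>s\<in>S. s \<le> x) \<longrightarrow> j \<le> x)"

class bicomplete_preorder = preorder +
  assumes meet_exists: "\<exists>m. is_meet S m"
    and join_exists: "\<exists>j. is_join S j"

text \<open>
  \<^const>\<open>mono\<close> is restricted to partially ordered codomains, hence \<^const>\<open>monotone\<close>. The
  monad laws hold automatically, because all diagrams commute.
\<close>

definition monad :: "('a::preorder \<Rightarrow> 'a) \<Rightarrow> bool" where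
  "monad F \<longleftrightarrow> monotone (\<le>) (\<le>) F \<and> (\<forall>x. x \<le> F x) \<and> (\<forall>x. F (F x) \<le> F x)"

definition comonad :: "('a::preorder \<Rightarrow> 'a) \<Rightarrow> bool" where
  "comonad C \<longleftrightarrow> monotone (\<le>) (\<le>) C \<and> (\<forall>x. C x \<le> x) \<and> (\<forall>x. C x \<le> C (C x))"

definition idempotent :: "('a::preorder \<Rightarrow> 'a) \<Rightarrow> bool" where
  "idempotent F \<longleftrightarrow> (\<forall>x. F (F x) \<cong> F x)"

text \<open>
  Naturality, and compatibility with (co)monad structures, are automatic.
\<close>

definition naturally_isomorphic :: "('a \<Rightarrow> 'b::preorder) \<Rightarrow> ('a \<Rightarrow> 'b) \<Rightarrow> bool" where
  "naturally_isomorphic F G \<longleftrightarrow> (\<forall>x. F x \<cong> G x)"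

text \<open>
  \<open>f\<close> has the left lifting property with respect to \<open>g\<close>: every square from \<open>f\<close> to \<open>g\<close> has a
  diagonal filler.
\<close>

definition lifts :: "'a::preorder \<times> 'a \<Rightarrow> 'a \<times> 'a \<Rightarrow> bool" where
  "lifts f g \<longleftrightarrow> (fst f \<le> fst g \<longrightarrow> snd f \<le> snd g \<longrightarrow> snd f \<le> fst g)"

definition weak_factorization_system ::
    "('a::preorder \<times> 'a) set \<Rightarrow> ('a \<times> 'a) set \<Rightarrow> bool" where
  "weak_factorization_system L R \<longleftrightarrow>
     (\<forall>(x, y)\<in>arrows. \<exists>z. (x, z) \<in> L \<and> (z, y) \<in> R) \<and>
     L = {f \<in> arrows. \<forall>g\<in>R. lifts f g} \<and>
     R = {g \<in> arrows. \<forall>f\<in>L. lifts f g}"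

text \<open>
  A retract in the category of arrows: maps \<open>f \<rightarrow> g \<rightarrow> f\<close>, whose composite is necessarily the
  identity.
\<close>

definition retract_of :: "'a::preorder \<times> 'a \<Rightarrow> 'a \<times> 'a \<Rightarrow> bool" where
  "retract_of f g \<longleftrightarrow>
     (fst f \<le> fst g \<and> snd f \<le> snd g) \<and> (fst g \<le> fst f \<and> snd g \<le> snd f)"

definition retract_closed :: "('a::preorder \<times> 'a) set \<Rightarrow> bool" where
  "retract_closed K \<longleftrightarrow> (\<forall>f\<in>arrows. \<forall>g\<in>K. retract_of f g \<longrightarrow> f \<in> K)"

text \<open>
  Reflexivity says that \<open>K\<close> contains all identities, hence all objects; transitivity says that
  it is closed under composition.
\<close>

definition wide_subcategory :: "('a::preorder \<times> 'a) set \<Rightarrow> bool" where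
  "wide_subcategory K \<longleftrightarrow> K \<subseteq> arrows \<and> refl K \<and> trans K"

definition two_out_of_three :: "('a::preorder \<times> 'a) set \<Rightarrow> bool" where
  "two_out_of_three W \<longleftrightarrow>
     (\<forall>x y z. x \<le> y \<longrightarrow> y \<le> z \<longrightarrow>
        ((x, y) \<in> W \<and> (y, z) \<in> W \<longrightarrow> (x, z) \<in> W) \<and>
        ((x, y) \<in> W \<and> (x, z) \<in> W \<longrightarrow> (y, z) \<in> W) \<and>
        ((y, z) \<in> W \<and> (x, z) \<in> W \<longrightarrow> (x, y) \<in> W))"

definition model_structure ::
    "('a::preorder \<times> 'a) set \<Rightarrow> ('a \<times> 'a) set \<Rightarrow> ('a \<times> 'a) set \<Rightarrow> bool" where
  "model_structure cof we fib \<longleftrightarrow>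
     wide_subcategory cof \<and> retract_closed cof \<and>
     wide_subcategory we \<and> retract_closed we \<and>
     wide_subcategory fib \<and> retract_closed fib \<and>
     weak_factorization_system (cof \<inter> we) fib \<and>
     weak_factorization_system cof (we \<inter> fib) \<and>
     two_out_of_three we"

definition fibrant_replacement ::
    "('a::preorder \<times> 'a) set \<Rightarrow> ('a \<times> 'a) set \<Rightarrow> ('a \<times> 'a) set \<Rightarrow> 'a \<Rightarrow> 'a \<Rightarrow> bool" where
  "fibrant_replacement cof we fib x y \<longleftrightarrow>
     (x, y) \<in> cof \<inter> we \<and> (\<exists>t. is_terminal t \<and> (y, t) \<in> fib)"

definition cofibrant_replacement ::
    "('a::preorder \<times> 'a) set \<Rightarrow> ('a \<times> 'a) set \<Rightarrow> ('a \<times> 'a) set \<Rightarrow> 'a \<Rightarrow> 'a \<Rightarrow> bool" where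
  "cofibrant_replacement cof we fib x y \<longleftrightarrow>
     (\<exists>z. is_initial z \<and> (z, y) \<in> cof) \<and> (y, x) \<in> we \<inter> fib"

text \<open>
  Replacements are unique only up to isomorphism, so the replacement monad and comonad are
  given as predicates, satisfied by every (co)monad that is a choice of replacements.
\<close>

definition fibrant_replacement_monad ::
    "('a::preorder \<times> 'a) set \<Rightarrow> ('a \<times> 'a) set \<Rightarrow> ('a \<times> 'a) set \<Rightarrow> ('a \<Rightarrow> 'a) \<Rightarrow> bool" where
  "fibrant_replacement_monad cof we fib P \<longleftrightarrow>
     monad P \<and> (\<forall>x. fibrant_replacement cof we fib x (P x))"

definition cofibrant_replacement_comonad ::
    "('a::preorder \<times> 'a) set \<Rightarrow> ('a \<times> 'a) set \<Rightarrow> ('a \<times> 'a) set \<Rightarrow> ('a \<Rightarrow> 'a) \<Rightarrow> bool" where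
  "cofibrant_replacement_comonad cof we fib Q \<longleftrightarrow>
     comonad Q \<and> (\<forall>x. cofibrant_replacement cof we fib x (Q x))"

end

theory Submission
  imports Defs
begin

text \<open>
  In a bicomplete preorder every set \<open>I\<close> of maps generates a weak factorization system with right
  class \<open>rlp I\<close>: to factor \<open>x \<le> y\<close>, take the meet of all \<open>a \<ge> x\<close> with \<open>(a, y) \<in> rlp I\<close>.

  Given (ii), the weak equivalences are forced to be the \<open>x \<le> y\<close> with \<open>C y \<le> F x\<close>. Acyclic
  cofibrations must contain every \<open>x \<le> F x\<close>, and also every weak equivalence with cofibrant
  codomain; these two families are taken as generators. The acyclic fibrations are then the maps
  with the right lifting property against all \<open>x \<le> F x\<close> and \<open>0 \<le> C y\<close>, and the last condition in
  (ii) says precisely that \<open>C y \<le> y\<close> is one of them.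

  For the converse, \<open>F (C x) \<le> F x\<close> is a weak equivalence by two-out-of-three and a fibration
  because its domain is fibrant, so \<open>C (F x)\<close> lifts along it.
\<close>

section \<open>Lifting classes and the weak factorization systems they generate\<close>

definition llp :: "('a::preorder \<times> 'a) set \<Rightarrow> ('a \<times> 'a) set" where
  "llp R = {f \<in> arrows. \<forall>g\<in>R. lifts f g}"

definition rlp :: "('a::preorder \<times> 'a) set \<Rightarrow> ('a \<times> 'a) set" where
  "rlp L = {g \<in> arrows. \<forall>f\<in>L. lifts f g}"

lemma llp_iff: "(x, y) \<in> llp R \<longleftrightarrow> x \<le> y \<and> (\<forall>(a, b)\<in>R. x \<le> a \<longrightarrow> y \<le> b \<longrightarrow> y \<le> a)"
  by (auto simp: llp_def arrows_def lifts_def)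

lemma rlp_iff: "(a, b) \<in> rlp L \<longleftrightarrow> a \<le> b \<and> (\<forall>(x, y)\<in>L. x \<le> a \<longrightarrow> y \<le> b \<longrightarrow> y \<le> a)"
  by (auto simp: rlp_def arrows_def lifts_def)

lemma wide_subcategory_llp: "wide_subcategory (llp R)"
  unfolding wide_subcategory_def
proof (intro conjI)
  show "trans (llp R)"
    by (rule transI) (fastforce simp: llp_iff intro: order_trans)
qed (auto simp: llp_def refl_on_def arrows_def lifts_def)

lemma wide_subcategory_rlp: "wide_subcategory (rlp L)"
  unfolding wide_subcategory_def
proof (intro conjI)
  show "trans (rlp L)"
    by (rule transI) (fastforce simp: rlp_iff intro: order_trans)
qed (auto simp: rlp_def refl_on_def arrows_def lifts_def)

lemma retract_closed_llp: "retract_closed (llp R)"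
  unfolding retract_closed_def retract_of_def
  by (fastforce simp: llp_iff arrows_def intro: order_trans)

lemma retract_closed_rlp: "retract_closed (rlp L)"
  unfolding retract_closed_def retract_of_def
proof (clarsimp simp: arrows_def)
  fix a b c d
  assume *: "a \<le> b" "(c, d) \<in> rlp L" "a \<le> c" "b \<le> d" "c \<le> a" "d \<le> b"
  have "y \<le> a" if "(x, y) \<in> L" "x \<le> a" "y \<le> b" for x y
  proof -
    have "x \<le> c" "y \<le> d"
      using that * by (blast intro: order_trans)+
    then have "y \<le> c"
      using *(2) that(1) by (auto simp: rlp_iff)
    then show ?thesis
      using *(5) by (rule order_trans)
  qed
  then show "(a, b) \<in> rlp L"
    using *(1) by (auto simp: rlp_iff)
qed

text \<open>A triangle identity of the Galois connection between \<open>llp\<close> and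
  \<open>rlp\<close>. As \<open>llp\<close> contains only arrows, the hypothesis on \<open>L\<close>
  is what places \<open>L\<close> inside \<open>llp (rlp L)\<close>.\<close>

lemma rlp_llp_rlp:
  assumes "L \<subseteq> arrows"
  shows "rlp (llp (rlp L)) = rlp L"
proof
  show "rlp L \<subseteq> rlp (llp (rlp L))"
    by (auto simp: rlp_def llp_def)
  have "L \<subseteq> llp (rlp L)"
    using assms by (auto simp: rlp_def llp_def)
  then show "rlp (llp (rlp L)) \<subseteq> rlp L"
    by (auto simp: rlp_def)
qed

text \<open>An order-theoretic small object argument: the objects \<open>a\<close> with
  \<open>(a, y)\<close> in \<open>rlp L\<close> are stable under nonempty meets, so a least one
  above \<open>x\<close> exists.\<close>

lemma rlp_factorization:
  fixes x y :: "'a::bicomplete_preorder"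
  assumes "x \<le> y"
  shows "\<exists>z. (x, z) \<in> llp (rlp L) \<and> (z, y) \<in> rlp L"
proof -
  let ?S = "{a. x \<le> a \<and> (a, y) \<in> rlp L}"
  obtain z where z: "is_meet ?S z"
    using meet_exists by blast
  have z_le: "z \<le> a" if "a \<in> ?S" for a
    using z that by (auto simp: is_meet_def)
  have le_z: "w \<le> z" if "\<And>a. a \<in> ?S \<Longrightarrow> w \<le> a" for w
    using z that by (auto simp: is_meet_def)
  have "x \<le> z"
    by (rule le_z) auto
  have "y \<in> ?S"
    using assms by (auto simp: rlp_iff)
  then have "z \<le> y"
    by (rule z_le)
  have R: "(z, y) \<in> rlp L"
    unfolding rlp_iff
  proof (safe intro!: \<open>z \<le> y\<close> le_z)
    fix p q a
    assume pq: "(p, q) \<in> L" "p \<le> z" "q \<le> y" and a: "x \<le> a" "(a, y) \<in> rlp L"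
    have "p \<le> a"
      using pq(2) z_le a by (blast intro: order_trans)
    then show "q \<le> a"
      using a(2) pq by (auto simp: rlp_iff)
  qed
  \<comment> \<open>With \<open>m\<close> the meet of \<open>a\<close> and \<open>z\<close>, the map
    \<open>m \<le> z\<close> is the pullback of \<open>a \<le> b\<close> along
    \<open>z \<le> b\<close>, hence again in \<open>rlp L\<close>. Composing with
    \<open>(z, y)\<close> puts \<open>m\<close> into \<open>?S\<close>, and minimality of
    \<open>z\<close> gives \<open>z \<le> m \<le> a\<close>.\<close>
  have "z \<le> a" if ab: "(a, b) \<in> rlp L" "x \<le> a" "z \<le> b" for a b
  proof -
    obtain m where m: "is_meet {a, z} m"
      using meet_exists by blast
    then have m_le: "m \<le> a" "m \<le> z" and le_m: "w \<le> a \<Longrightarrow> w \<le> z \<Longrightarrow> w \<le> m" for w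
      by (auto simp: is_meet_def)
    have "(m, z) \<in> rlp L"
      unfolding rlp_iff
    proof (safe intro!: m_le le_m)
      fix p q
      assume pq: "(p, q) \<in> L" "p \<le> m" "q \<le> z"
      have "p \<le> a" "q \<le> b"
        using pq m_le ab(3) by (blast intro: order_trans)+
      then show "q \<le> a"
        using ab(1) pq(1) by (auto simp: rlp_iff)
    qed
    then have "(m, y) \<in> rlp L"
      using R wide_subcategory_rlp[of L] unfolding wide_subcategory_def by (blast dest: transD)
    then have "z \<le> m"
      using le_m[OF ab(2) \<open>x \<le> z\<close>] z_le by auto
    then show ?thesis
      using m_le(1) by (rule order_trans)
  qed
  then have "(x, z) \<in> llp (rlp L)"
    using \<open>x \<le> z\<close> by (auto simp: llp_iff)
  with R show ?thesis
    by blast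
qed

lemma weak_factorization_system_rlp:
  fixes L :: "('a::bicomplete_preorder \<times> 'a) set"
  assumes "L \<subseteq> arrows"
  shows "weak_factorization_system (llp (rlp L)) (rlp L)"
  unfolding weak_factorization_system_def
proof (intro conjI)
  show "\<forall>(x, y)\<in>arrows. \<exists>z. (x, z) \<in> llp (rlp L) \<and> (z, y) \<in> rlp L"
    using rlp_factorization by (fastforce simp: arrows_def)
  show "llp (rlp L) = {f \<in> arrows. \<forall>g\<in>rlp L. lifts f g}"
    by (simp add: llp_def)
  show "rlp L = {g \<in> arrows. \<forall>f\<in>llp (rlp L). lifts f g}"
    using rlp_llp_rlp[OF assms] by (simp add: rlp_def)
qed

lemma wfs_left_eq: "weak_factorization_system L R \<Longrightarrow> L = llp R"
  unfolding weak_factorization_system_def llp_def by (elim conjE)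

lemma wfs_right_eq: "weak_factorization_system L R \<Longrightarrow> R = rlp L"
  unfolding weak_factorization_system_def rlp_def by (elim conjE)

lemma wfs_lift:
  assumes "weak_factorization_system L R" "(x, y) \<in> L" "(a, b) \<in> R" "x \<le> a" "y \<le> b"
  shows "y \<le> a"
proof -
  have "(x, y) \<in> llp R"
    using assms(2) wfs_left_eq[OF assms(1)] by simp
  then show ?thesis
    using assms(3-) by (auto simp: llp_iff)
qed

text \<open>Every map ends below \<open>t\<close>, so lifting against \<open>(a, t)\<close>
  constrains only the source; the resulting fillers also serve squares against
  \<open>(a, b)\<close>.\<close>

lemma wfs_out_of_fibrant:
  assumes wfs: "weak_factorization_system L R"
    and "is_terminal t" "(a, t) \<in> R" "a \<le> b"
  shows "(a, b) \<in> R"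
proof -
  have "y \<le> a" if "(x, y) \<in> L" "x \<le> a" for x y
    using wfs_lift[OF wfs that(1) assms(3) that(2)] assms(2) by (auto simp: is_terminal_def)
  then have "(a, b) \<in> rlp L"
    using assms(4) by (auto simp: rlp_iff)
  then show ?thesis
    using wfs_right_eq[OF wfs] by simp
qed

section \<open>From a model structure to the conditions on its replacements\<close>

lemma replacements_commute_and_lift:
  assumes ms: "model_structure cof we fib"
    and Q: "cofibrant_replacement_comonad cof we fib Q"
    and P: "fibrant_replacement_monad cof we fib P"
  shows "P (Q x) \<cong> Q (P x)"
    and "x \<le> Q y \<Longrightarrow> P x \<le> y \<Longrightarrow> P x \<le> Q y"
proof -
  have wfs1: "weak_factorization_system (cof \<inter> we) fib"
    and wfs2: "weak_factorization_system cof (we \<inter> fib)"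
    and w23: "two_out_of_three we"
    using ms by (auto simp: model_structure_def)
  have P_AC: "(x, P x) \<in> cof \<inter> we" and P_fib: "\<exists>t. is_terminal t \<and> (P x, t) \<in> fib" for x
    using P by (auto simp: fibrant_replacement_monad_def fibrant_replacement_def)
  have Q_AF: "(Q x, x) \<in> we \<inter> fib" and Q_cof: "\<exists>z. is_initial z \<and> (z, Q x) \<in> cof" for x
    using Q by (auto simp: cofibrant_replacement_comonad_def cofibrant_replacement_def)
  have P_mono: "x \<le> y \<Longrightarrow> P x \<le> P y" for x y
    using P by (auto simp: fibrant_replacement_monad_def monad_def monotone_on_def)
  have Q_mono: "x \<le> y \<Longrightarrow> Q x \<le> Q y" for x y
    using Q by (auto simp: cofibrant_replacement_comonad_def comonad_def monotone_on_def)
  have le_P: "x \<le> P x" for x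
    using P by (auto simp: fibrant_replacement_monad_def monad_def)
  have Q_le: "Q x \<le> x" for x
    using Q by (auto simp: cofibrant_replacement_comonad_def comonad_def)
  show lift: "P x \<le> Q y" if "x \<le> Q y" "P x \<le> y" for x y
    using wfs_lift[OF wfs1 P_AC _ that] Q_AF by blast
  \<comment> \<open>This is \<open>lift\<close> at the objects \<open>Q x\<close> and
    \<open>P x\<close>.\<close>
  have "P (Q x) \<le> Q (P x)"
    by (intro lift Q_mono le_P P_mono Q_le)
  moreover have "Q (P x) \<le> P (Q x)"
  proof -
    have le: "P (Q x) \<le> P x"
      by (intro P_mono Q_le)
    \<comment> \<open>Two-out-of-three is used twice: to compose
      \<open>Q x \<le> x \<le> P x\<close>, then to cancel \<open>Q x \<le> P (Q x)\<close> from the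
      composite.\<close>
    have "(Q x, P x) \<in> we"
      using w23 Q_AF[of x] P_AC[of x] Q_le le_P unfolding two_out_of_three_def by blast
    moreover have "(Q x, P (Q x)) \<in> we"
      using P_AC by blast
    ultimately have "(P (Q x), P x) \<in> we"
      using w23 le_P[of "Q x"] le unfolding two_out_of_three_def by blast
    moreover have "(P (Q x), P x) \<in> fib"
      using P_fib[of "Q x"] wfs_out_of_fibrant[OF wfs1 _ _ le] by blast
    ultimately have "(P (Q x), P x) \<in> we \<inter> fib"
      by blast
    moreover obtain z where "is_initial z" "(z, Q (P x)) \<in> cof"
      using Q_cof by blast
    ultimately show ?thesis
      using wfs_lift[OF wfs2] Q_le by (auto simp: is_initial_def)
  qed
  ultimately show "P (Q x) \<cong> Q (P x)"
    by (simp add: iso_def)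
qed

section \<open>Construction of a model structure from the monad and the comonad\<close>

lemma model_structure_exists:
  fixes F C :: "'a::bicomplete_preorder \<Rightarrow> 'a"
  assumes F: "monad F" and C: "comonad C"
    and CF_le: "\<And>x. C (F x) \<le> F (C x)"
    and lift: "\<And>x y. x \<le> C y \<Longrightarrow> F x \<le> y \<Longrightarrow> F x \<le> C y"
  shows "\<exists>cof we fib. model_structure cof we fib \<and>
    cofibrant_replacement_comonad cof we fib C \<and> fibrant_replacement_monad cof we fib F"
proof -
  have F_mono: "x \<le> y \<Longrightarrow> F x \<le> F y" and le_F: "x \<le> F x" and FF: "F (F x) \<le> F x" for x y
    using F by (auto simp: monad_def monotone_on_def)
  have C_mono: "x \<le> y \<Longrightarrow> C x \<le> C y" and C_le: "C x \<le> x" and CC: "C x \<le> C (C x)" for x y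
    using C by (auto simp: comonad_def monotone_on_def)
  \<comment> \<open>In a model structure with these replacements, a weak equivalence
    \<open>x \<le> y\<close> makes \<open>F x \<le> F y\<close> an acyclic fibration, along which
    the cofibrant \<open>C y\<close> lifts to give \<open>C y \<le> F x\<close>.\<close>
  define W where "W = {(x, y). x \<le> y \<and> C y \<le> F x}"
  \<comment> \<open>Since \<open>C (C y) \<cong> C y\<close>, the second family consists of the maps
    in \<open>W\<close> with codomain \<open>C y\<close>.\<close>
  define I where "I = {(x, F x) |x. True} \<union> {(x, C y) |x y. x \<le> C y \<and> C y \<le> F x}"
  define J where "J = {(x, F x) |x. True} \<union> {(z, C y) |z y. is_initial z}"
  have I_arrows: "I \<subseteq> arrows" and J_arrows: "J \<subseteq> arrows"
    using le_F by (auto simp: I_def J_def arrows_def is_initial_def)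
  have fib_iff: "(a, b) \<in> rlp I \<longleftrightarrow> a \<le> b \<and> (\<forall>x. x \<le> a \<longrightarrow> F x \<le> b \<longrightarrow> F x \<le> a) \<and>
      (\<forall>x y. x \<le> C y \<longrightarrow> C y \<le> F x \<longrightarrow> x \<le> a \<longrightarrow> C y \<le> b \<longrightarrow> C y \<le> a)" for a b
    unfolding rlp_iff I_def by blast
  obtain z0 :: 'a where z0: "is_initial z0"
    using meet_exists[of UNIV] by (auto simp: is_meet_def is_initial_def)
  obtain t0 :: 'a where t0: "is_terminal t0"
    using join_exists[of UNIV] by (auto simp: is_join_def is_terminal_def)
  have F_fib: "(F x, t0) \<in> rlp I" for x
  proof -
    \<comment> \<open>This settles both families of generators: in the second,
      \<open>C y \<le> F w\<close> and \<open>w \<le> F x\<close> give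
      \<open>C y \<le> F x\<close>.\<close>
    have "F w \<le> F x" if "w \<le> F x" for w
      using F_mono[OF that] FF by (rule order_trans)
    then show ?thesis
      using t0 unfolding fib_iff is_terminal_def by (blast intro: order_trans)
  qed
  \<comment> \<open>Lifting against all \<open>0 \<le> C y\<close> reduces to one inequality,
    because \<open>C y \<le> b\<close> forces \<open>C y \<le> C b\<close>.\<close>
  have AF_iff: "(a, b) \<in> rlp J \<longleftrightarrow>
      a \<le> b \<and> (\<forall>x. x \<le> a \<longrightarrow> F x \<le> b \<longrightarrow> F x \<le> a) \<and> C b \<le> a" for a b
  proof
    assume ab: "(a, b) \<in> rlp J"
    have "(z0, C b) \<in> J" and "z0 \<le> a"
      using z0 by (auto simp: J_def is_initial_def)
    then have "C b \<le> a"
      using ab C_le by (fastforce simp: rlp_iff)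
    then show "a \<le> b \<and> (\<forall>x. x \<le> a \<longrightarrow> F x \<le> b \<longrightarrow> F x \<le> a) \<and> C b \<le> a"
      using ab by (auto simp: rlp_iff J_def)
  next
    assume ab: "a \<le> b \<and> (\<forall>x. x \<le> a \<longrightarrow> F x \<le> b \<longrightarrow> F x \<le> a) \<and> C b \<le> a"
    have "C y \<le> a" if "C y \<le> b" for y
      using order_trans[OF CC C_mono[OF that]] ab by (blast intro: order_trans)
    then show "(a, b) \<in> rlp J"
      using ab by (auto simp: rlp_iff J_def)
  qed
  have AF: "W \<inter> rlp I = rlp J"
  proof (intro set_eqI iffI)
    fix f assume "f \<in> W \<inter> rlp I"
    moreover obtain a b where [simp]: "f = (a, b)"
      by fastforce
    ultimately have ab: "C b \<le> F a" and fib: "(a, b) \<in> rlp I"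
      by (auto simp: W_def)
    \<comment> \<open>The aim is \<open>C b \<le> F (C a)\<close>: it makes
      \<open>(C a, C b)\<close> a generator of the second family of \<open>I\<close>, which lifts
      against \<open>(a, b)\<close>.\<close>
    have "C b \<le> C (F a)"
      using CC C_mono[OF ab] by (rule order_trans)
    then have "C b \<le> F (C a)"
      using CF_le by (rule order_trans)
    moreover have "C a \<le> C b"
      using fib by (auto simp: rlp_iff intro: C_mono)
    ultimately have "C b \<le> a"
      using fib C_le unfolding fib_iff by blast
    then show "f \<in> rlp J"
      using fib by (auto simp: fib_iff AF_iff)
  next
    fix f assume "f \<in> rlp J"
    moreover obtain a b where [simp]: "f = (a, b)"
      by fastforce
    ultimately have ab: "(a, b) \<in> rlp J"
      by simp
    have "C y \<le> a" if "C y \<le> b" for y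
      using order_trans[OF CC C_mono[OF that]] ab unfolding AF_iff by (blast intro: order_trans)
    then have "(a, b) \<in> rlp I"
      using ab by (auto simp: fib_iff AF_iff)
    moreover have "(a, b) \<in> W"
      using ab le_F unfolding AF_iff W_def by (auto intro: order_trans)
    ultimately show "f \<in> W \<inter> rlp I"
      by simp
  qed
  \<comment> \<open>\<open>CF_le\<close> bridges the middle object: \<open>C z\<close> lies below
    \<open>F y\<close>, hence below \<open>C (F y) \<le> F (C y)\<close>, and \<open>C y\<close>
    lies below \<open>F x\<close>.\<close>
  have W_comp: "(x, z) \<in> W" if "(x, y) \<in> W" "(y, z) \<in> W" for x y z
  proof -
    have "C z \<le> C (C z)" by (rule CC)
    also have "C (C z) \<le> C (F y)"
      using that by (auto simp: W_def intro: C_mono)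
    also have "C (F y) \<le> F (C y)" by (rule CF_le)
    also have "F (C y) \<le> F (F x)"
      using that by (auto simp: W_def intro: F_mono)
    also have "F (F x) \<le> F x" by (rule FF)
    finally show ?thesis
      using that by (auto simp: W_def intro: order_trans)
  qed
  have W_right: "(y, z) \<in> W" if "x \<le> y" "y \<le> z" "(x, z) \<in> W" for x y z
    using that F_mono[OF that(1)] unfolding W_def by (auto intro: order_trans)
  have W_left: "(x, y) \<in> W" if "x \<le> y" "y \<le> z" "(x, z) \<in> W" for x y z
    using that C_mono[OF that(2)] unfolding W_def by (auto intro: order_trans)
  have "wide_subcategory W"
    unfolding wide_subcategory_def
  proof (intro conjI)
    show "W \<subseteq> arrows"
      by (auto simp: W_def arrows_def)
    show "refl W"
      using C_le le_F by (auto simp: refl_on_def W_def intro: order_trans)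
    show "trans W"
      using W_comp by (blast intro: transI)
  qed
  moreover have "retract_closed W"
    unfolding retract_closed_def retract_of_def
  proof (clarsimp simp: arrows_def)
    fix a b c d
    assume *: "a \<le> b" "(c, d) \<in> W" "a \<le> c" "b \<le> d" "c \<le> a" "d \<le> b"
    have "C b \<le> C d" "C d \<le> F c" "F c \<le> F a"
      using * by (auto simp: W_def intro: C_mono F_mono)
    then show "(a, b) \<in> W"
      using *(1) by (auto simp: W_def intro: order_trans)
  qed
  moreover have "two_out_of_three W"
    using W_comp W_left W_right unfolding two_out_of_three_def by blast
  moreover have AC: "llp (rlp J) \<inter> W = llp (rlp I)"
  proof (intro equalityI subrelI)
    fix x y assume xy: "(x, y) \<in> llp (rlp I)"
    then have "(x, y) \<in> llp (rlp J)"
      using AF by (auto simp: llp_def)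
    \<comment> \<open>Lift \<open>(x, y)\<close> against the fibration from \<open>F x\<close> to
      the terminal object.\<close>
    moreover have "y \<le> F x"
      using xy F_fib[of x] le_F t0 by (auto simp: llp_iff is_terminal_def)
    then have "(x, y) \<in> W"
      using xy C_le unfolding W_def by (auto simp: llp_iff intro: order_trans)
    ultimately show "(x, y) \<in> llp (rlp J) \<inter> W"
      by blast
  next
    fix x y assume xy: "(x, y) \<in> llp (rlp J) \<inter> W"
    then have "x \<le> y"
      by (auto simp: W_def)
    \<comment> \<open>The retract argument: the second factor is an acyclic fibration by
      two-out-of-three, so \<open>(x, y)\<close> lifts against it and
      \<open>y \<cong> z\<close>.\<close>
    then obtain z where z: "(x, z) \<in> llp (rlp I)" "(z, y) \<in> rlp I"
      using rlp_factorization by blast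
    then have le: "x \<le> z" "z \<le> y"
      by (auto simp: llp_iff rlp_iff)
    then have "(z, y) \<in> W"
      using W_right xy by blast
    then have "(z, y) \<in> rlp J"
      using z(2) AF by blast
    then have "y \<le> z"
      using xy le(1) by (auto simp: llp_iff)
    then have "retract_of (x, y) (x, z)"
      using le by (simp add: retract_of_def)
    then show "(x, y) \<in> llp (rlp I)"
      using retract_closed_llp[of "rlp I"] z(1) \<open>x \<le> y\<close>
      by (auto simp: retract_closed_def arrows_def)
  qed
  ultimately have "model_structure (llp (rlp J)) W (rlp I)"
    unfolding model_structure_def AF
    using weak_factorization_system_rlp[OF I_arrows] weak_factorization_system_rlp[OF J_arrows]
    by (simp add: wide_subcategory_llp retract_closed_llp wide_subcategory_rlp retract_closed_rlp)
  moreover have "cofibrant_replacement_comonad (llp (rlp J)) W (rlp I) C"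
    unfolding cofibrant_replacement_comonad_def cofibrant_replacement_def AF
  proof (intro conjI allI C exI)
    fix x
    show "is_initial z0"
      by (rule z0)
    have "(z0, C x) \<in> J"
      using z0 by (auto simp: J_def)
    then show "(z0, C x) \<in> llp (rlp J)"
      using J_arrows by (auto simp: llp_def rlp_def)
    show "(C x, x) \<in> rlp J"
      using lift C_le by (simp add: AF_iff)
  qed
  moreover have "fibrant_replacement_monad (llp (rlp J)) W (rlp I) F"
    unfolding fibrant_replacement_monad_def fibrant_replacement_def AC
  proof (intro conjI allI F exI)
    fix x
    show "is_terminal t0"
      by (rule t0)
    have "(x, F x) \<in> I"
      by (auto simp: I_def)
    then show "(x, F x) \<in> llp (rlp I)"
      using I_arrows by (auto simp: llp_def rlp_def)
    show "(F x, t0) \<in> rlp I"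
      by (rule F_fib)
  qed
  ultimately show ?thesis
    by blast
qed

section \<open>The equivalence, with replacements matched up to isomorphism\<close>

theorem theorem1:
  fixes F C :: "'a::bicomplete_preorder \<Rightarrow> 'a"
  assumes "monad F" and "comonad C"
  shows
    "(\<exists>cof we fib. model_structure cof we fib \<and>
        (\<exists>Q. cofibrant_replacement_comonad cof we fib Q \<and> naturally_isomorphic Q C) \<and>
        (\<exists>P. fibrant_replacement_monad cof we fib P \<and> naturally_isomorphic P F))
     \<longleftrightarrow>
     (idempotent F \<and> idempotent C \<and>
        (\<forall>x. F (C x) \<cong> C (F x)) \<and>
        (\<forall>x y. x \<le> C y \<and> F x \<le> y \<longrightarrow> F x \<le> C y))"
    (is "?model \<longleftrightarrow> ?cond")
proof
  assume ?model
  then obtain cof we fib Q P where ms: "model_structure cof we fib"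
    and Q: "cofibrant_replacement_comonad cof we fib Q" and QC: "naturally_isomorphic Q C"
    and P: "fibrant_replacement_monad cof we fib P" and PF: "naturally_isomorphic P F"
    by blast
  have QC1: "Q x \<le> C x" and QC2: "C x \<le> Q x" and PF1: "P x \<le> F x" and PF2: "F x \<le> P x" for x
    using QC PF by (auto simp: naturally_isomorphic_def iso_def)
  have F_mono: "x \<le> y \<Longrightarrow> F x \<le> F y" and C_mono: "x \<le> y \<Longrightarrow> C x \<le> C y" for x y
    using assms by (auto simp: monad_def comonad_def monotone_on_def)
  \<comment> \<open>Both sides are compared through \<open>F (Q x)\<close>, so that only
    monotonicity of \<open>F\<close> is applied; likewise \<open>C (P x)\<close> below.\<close>
  have FC: "F (C x) \<le> P (Q x)" "P (Q x) \<le> F (C x)" for x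
    using order_trans[OF F_mono[OF QC2] PF2] order_trans[OF PF1 F_mono[OF QC1]] .
  have CF: "C (F x) \<le> Q (P x)" "Q (P x) \<le> C (F x)" for x
    using order_trans[OF C_mono[OF PF2] QC2] order_trans[OF QC1 C_mono[OF PF1]] .
  have PQ: "P (Q x) \<le> Q (P x)" "Q (P x) \<le> P (Q x)" for x
    using replacements_commute_and_lift(1)[OF ms Q P, of x] by (auto simp: iso_def)
  have "F x \<le> C y" if "x \<le> C y" "F x \<le> y" for x y
  proof -
    have "P x \<le> Q y"
      using order_trans[OF that(1) QC2] order_trans[OF PF1 that(2)]
      by (rule replacements_commute_and_lift(2)[OF ms Q P])
    then show ?thesis
      by (rule order_trans[OF PF2 order_trans[OF _ QC1]])
  qed
  moreover have "F (C x) \<cong> C (F x)" for x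
    unfolding iso_def
    using order_trans[OF FC(1) order_trans[OF PQ(1) CF(2)]]
      order_trans[OF CF(1) order_trans[OF PQ(2) FC(2)]] ..
  \<comment> \<open>The unit at \<open>F x\<close> and the counit at \<open>C x\<close> reverse the
    multiplication and comultiplication inequalities.\<close>
  moreover have "idempotent F" "idempotent C"
    using assms by (auto simp: idempotent_def iso_def monad_def comonad_def)
  ultimately show ?cond
    by blast
next
  assume ?cond
  then obtain cof we fib where "model_structure cof we fib"
    "cofibrant_replacement_comonad cof we fib C" "fibrant_replacement_monad cof we fib F"
    using model_structure_exists[OF assms] unfolding iso_def by blast
  \<comment> \<open>The replacements chosen are \<open>C\<close> and \<open>F\<close>
    themselves.\<close>
  moreover have "naturally_isomorphic G G" for G :: "'a \<Rightarrow> 'a"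
    by (simp add: naturally_isomorphic_def iso_def)
  ultimately show ?model
    by blast
qed

end
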